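(* If $G$ is a maximal outerplanar graph of order $n \ge 5$, then $\iota_1(G) \le \frac{n}{5}$.
   Context: A maximal outerplanar graph (mop) is a simple graph that can be embedded in the plane so that all vertices lie on the boundary of the exterior (unbounded) face and every interior face is a triangle. For a graph $G$ and $S \subseteq V(G)$, $N_G[S]$ denotes the closed neighborhood of $S$ (the vertices of $S$ together with all vertices adjacent to some vertex of $S$). A set $S \subseteq V(G)$ is a $K_{1,2}$-isolating set of $G$ if $G - N_G[S]$ (the graph obtained by deleting all vertices of $N_G[S]$) contains no copy of $K_{1,2}$ (i.e. no path on three vertices as a subgraph), equivalently every component of $G - N_G[S]$ has at most two vertices. $\iota_1(G)$ denotes the minimum size of a $K_{1,2}$-isolating set of $G$.
   Formalization: The definition of maximal outerplanar graph additionally requires the boundary of the exterior face to be a cycle of the graph; read literally, the stated definition also admits forests, and the path on 8 vertices has ι_1 = 2 > 8/5. *)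

theory Defs
  imports "HOL-Analysis.Analysis"
begin

text \<open>A graph is given by its vertex set \<open>V\<close> and its set \<open>E\<close> of edges, each edge being the
  two-element set of its endpoints.\<close>

definition simple_graph :: "'a set \<Rightarrow> 'a set set \<Rightarrow> bool" where
  "simple_graph V E \<longleftrightarrow> finite V \<and> (\<forall>e\<in>E. e \<subseteq> V \<and> card e = 2)"

definition cycle_edges :: "'a list \<Rightarrow> 'a set set" where
  "cycle_edges c = (\<lambda>i. {c ! i, c ! (Suc i mod length c)}) ` {..<length c}"

definition is_cycle :: "'a set \<Rightarrow> 'a set set \<Rightarrow> 'a list \<Rightarrow> bool" where
  "is_cycle V E c \<longleftrightarrow> length c \<ge> 3 \<and> distinct c \<and> set c \<subseteq> V \<and> cycle_edges c \<subseteq> E"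

text \<open>Vertices are drawn as distinct points of the plane (here the complex numbers), edges as
  simple arcs joining their endpoints which contain no other vertex and which meet each other in
  common endpoints only.\<close>

definition plane_embedding ::
    "'a set \<Rightarrow> 'a set set \<Rightarrow> ('a \<Rightarrow> complex) \<Rightarrow> ('a set \<Rightarrow> real \<Rightarrow> complex) \<Rightarrow> bool" where
  "plane_embedding V E pos \<gamma> \<longleftrightarrow>
     inj_on pos V \<and>
     (\<forall>e\<in>E. arc (\<gamma> e) \<and> {pathstart (\<gamma> e), pathfinish (\<gamma> e)} = pos ` e
            \<and> path_image (\<gamma> e) \<inter> pos ` V = pos ` e) \<and>
     (\<forall>e\<in>E. \<forall>f\<in>E. e \<noteq> f \<longrightarrow> path_image (\<gamma> e) \<inter> path_image (\<gamma> f) = pos ` (e \<inter> f))"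

definition drawing ::
    "'a set \<Rightarrow> 'a set set \<Rightarrow> ('a \<Rightarrow> complex) \<Rightarrow> ('a set \<Rightarrow> real \<Rightarrow> complex) \<Rightarrow> complex set" where
  "drawing V E pos \<gamma> = pos ` V \<union> (\<Union>e\<in>E. path_image (\<gamma> e))"

definition faces ::
    "'a set \<Rightarrow> 'a set set \<Rightarrow> ('a \<Rightarrow> complex) \<Rightarrow> ('a set \<Rightarrow> real \<Rightarrow> complex) \<Rightarrow> complex set set" where
  "faces V E pos \<gamma> = components (- drawing V E pos \<gamma>)"

definition bounded_by_cycle ::
    "'a set \<Rightarrow> 'a set set \<Rightarrow> ('a set \<Rightarrow> real \<Rightarrow> complex) \<Rightarrow> complex set \<Rightarrow> 'a list \<Rightarrow> bool" where
  "bounded_by_cycle V E \<gamma> F c \<longleftrightarrow>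
     is_cycle V E c \<and> frontier F = (\<Union>e\<in>cycle_edges c. path_image (\<gamma> e))"

text \<open>The unbounded face is the exterior one, the bounded faces are the interior ones. As usual for
  maximal outerplanar graphs (of order at least 3), the boundary of the exterior face is understood
  to be a cycle of the graph. Without this, every forest would qualify, having no interior face at
  all, and so would a disjoint union of triangles; these graphs are outerplanar but not maximal
  with this property.\<close>

definition maximal_outerplanar :: "'a set \<Rightarrow> 'a set set \<Rightarrow> bool" where
  "maximal_outerplanar V E \<longleftrightarrow>
     simple_graph V E \<and>
     (\<exists>pos \<gamma>. plane_embedding V E pos \<gamma> \<and>
        (\<forall>F\<in>faces V E pos \<gamma>. \<not> bounded F \<longrightarrow>
            pos ` V \<subseteq> frontier F \<and> (\<exists>c. bounded_by_cycle V E \<gamma> F c)) \<and>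
        (\<forall>F\<in>faces V E pos \<gamma>. bounded F \<longrightarrow>
            (\<exists>c. length c = 3 \<and> bounded_by_cycle V E \<gamma> F c)))"

definition closed_nbhd :: "'a set \<Rightarrow> 'a set set \<Rightarrow> 'a set \<Rightarrow> 'a set" where
  "closed_nbhd V E S = S \<union> {v \<in> V. \<exists>u\<in>S. {u, v} \<in> E}"

definition delete_edges :: "'a set set \<Rightarrow> 'a set \<Rightarrow> 'a set set" where
  "delete_edges E X = {e \<in> E. e \<inter> X = {}}"

definition contains_K12 :: "'a set \<Rightarrow> 'a set set \<Rightarrow> bool" where
  "contains_K12 V E \<longleftrightarrow>
     (\<exists>a b c. distinct [a, b, c] \<and> {a, b, c} \<subseteq> V \<and> {a, b} \<in> E \<and> {b, c} \<in> E)"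

definition K12_isolating :: "'a set \<Rightarrow> 'a set set \<Rightarrow> 'a set \<Rightarrow> bool" where
  "K12_isolating V E S \<longleftrightarrow> S \<subseteq> V \<and>
     \<not> contains_K12 (V - closed_nbhd V E S) (delete_edges E (closed_nbhd V E S))"

definition iota1 :: "'a set \<Rightarrow> 'a set set \<Rightarrow> nat" where
  "iota1 V E = (LEAST k. \<exists>S. K12_isolating V E S \<and> card S = k)"

end

theory Submission imports Defs begin

text \<open>
  The boundary cycle of the exterior face passes through all vertices, and the theta-curve form of
  the Jordan curve theorem shows that chords do not cross: no vertex lies inside a cycle of the
  graph, as it would be separated from the exterior face. For an edge \<open>ij\<close>, the bounded face
  touching \<open>ij\<close> from inside the cycle formed by \<open>ij\<close> and the boundary path from \<open>i\<close> to \<open>j\<close> is a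
  triangle, whose third vertex lies on that path. Thus the graph is a triangulated polygon.

  For a triangulated polygon, choose an edge \<open>ij\<close> cutting off as few boundary edges \<open>k \<ge> 5\<close> as
  possible. The triangle \<open>itj\<close> on the cut-off side splits \<open>k\<close> into two parts of at most 4 edges each.
  If \<open>k \<ge> 6\<close>, the vertex \<open>t\<close> dominates \<open>i\<close> and \<open>j\<close> and isolates the cut-off part, and the at least
  5 vertices strictly between \<open>i\<close> and \<open>j\<close> can be removed. If \<open>k = 5\<close>, one of \<open>i\<close>, \<open>j\<close> isolates
  the cut-off part; removing its 4 inner vertices and contracting \<open>ij\<close> to a single vertex again
  removes 5 vertices. Both reductions collapse an interval of boundary vertices to one vertex, which
  turns a triangulated polygon into a triangulated polygon.
\<close>

section \<open>Triangulated polygons\<close>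

text \<open>The vertices are numbered in their cyclic order. Axiom \<open>apex\<close> speaks about only one side of the
  edge \<open>xy\<close>; by \<open>noncrossing\<close> and \<open>adj_root\<close> this is enough.\<close>

locale polygon_triangulation =
  fixes n :: nat and adj :: "nat \<Rightarrow> nat \<Rightarrow> bool"
  assumes adj_less: "adj x y \<Longrightarrow> x < n"
    and adj_sym: "adj x y \<Longrightarrow> adj y x"
    and adj_irrefl: "\<not> adj x x"
    and adj_Suc: "Suc x < n \<Longrightarrow> adj x (Suc x)"
    and adj_root: "adj 0 (n - 1)"
    and noncrossing: "\<lbrakk>adj a b; adj c d; a < c; c < b; b < d\<rbrakk> \<Longrightarrow> False"
    and apex: "\<lbrakk>adj x y; Suc x < y\<rbrakk> \<Longrightarrow> \<exists>m. x < m \<and> m < y \<and> adj x m \<and> adj m y"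

section \<open>Contracting an interval of boundary vertices\<close>

definition collapse :: "nat \<Rightarrow> nat \<Rightarrow> nat \<Rightarrow> nat" where
  "collapse i l x = (if x \<le> i then x else if x \<le> i + l then i else x - l)"

text \<open>The quotient graph. The condition \<open>x \<noteq> y\<close> discards the loops that
  come from edges inside the contracted interval.\<close>

definition collapsed_adj :: "(nat \<Rightarrow> nat \<Rightarrow> bool) \<Rightarrow> nat \<Rightarrow> nat \<Rightarrow> nat \<Rightarrow> nat \<Rightarrow> bool" where
  "collapsed_adj adj i l x y \<longleftrightarrow>
     x \<noteq> y \<and> (\<exists>x' y'. adj x' y' \<and> collapse i l x' = x \<and> collapse i l y' = y)"

definition undominated :: "(nat \<Rightarrow> nat \<Rightarrow> bool) \<Rightarrow> nat set \<Rightarrow> nat \<Rightarrow> bool" where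
  "undominated adj S v \<longleftrightarrow> v \<notin> S \<and> (\<forall>s\<in>S. \<not> adj s v)"

text \<open>Only the path is confined to \<open>A\<close>; dominating vertices may lie anywhere.
  This allows the two sides of an edge to be checked separately.\<close>

definition isolates :: "(nat \<Rightarrow> nat \<Rightarrow> bool) \<Rightarrow> nat set \<Rightarrow> nat set \<Rightarrow> bool" where
  "isolates adj A S \<longleftrightarrow> (\<forall>u\<in>A. \<forall>v\<in>A. \<forall>w\<in>A. adj u v \<longrightarrow> adj v w \<longrightarrow> u \<noteq> w \<longrightarrow>
     undominated adj S u \<longrightarrow> undominated adj S v \<longrightarrow> \<not> undominated adj S w)"

lemma collapse_mono: "x \<le> y \<Longrightarrow> collapse i l x \<le> collapse i l y"
  by (auto simp: collapse_def)

lemma collapse_less_imp_less: "collapse i l x < collapse i l y \<Longrightarrow> x < y"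
  using collapse_mono[of y x i l] by linarith

lemma collapsed_adjI:
  "\<lbrakk>adj x y; collapse i l x \<noteq> collapse i l y\<rbrakk> \<Longrightarrow>
    collapsed_adj adj i l (collapse i l x) (collapse i l y)"
  unfolding collapsed_adj_def by blast

lemma three_distinct_le_card:
  assumes "finite A" "u \<in> A" "v \<in> A" "w \<in> A" "u \<noteq> v" "v \<noteq> w" "u \<noteq> w"
  shows "3 \<le> card A"
proof -
  have "card {u, v, w} \<le> card A"
    using assms by (intro card_mono) auto
  then show ?thesis
    using assms by simp
qed

context polygon_triangulation
begin

text \<open>Induction on the length of a preimage edge: if its apex \<open>m\<close> has the same
  image as one end, replacing that end by \<open>m\<close> gives a shorter edge with the same
  image.\<close>

lemma collapsed_apex:
  assumes "adj x' y'" "Suc (collapse i l x') < collapse i l y'"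
  shows "\<exists>m. collapse i l x' < m \<and> m < collapse i l y' \<and>
    collapsed_adj adj i l (collapse i l x') m \<and> collapsed_adj adj i l m (collapse i l y')"
  using assms
proof (induction "y' - x'" arbitrary: x' y' rule: less_induct)
  case less
  let ?c = "collapse i l"
  have "Suc x' < y'"
    using less.prems(2) by (auto simp: collapse_def split: if_splits)
  then obtain m where m: "x' < m" "m < y'" "adj x' m" "adj m y'"
    using apex[OF less.prems(1)] by blast
  have "?c x' \<le> ?c m" "?c m \<le> ?c y'"
    using m by (auto intro!: collapse_mono)
  then consider "?c m = ?c x'" | "?c m = ?c y'" | "?c x' < ?c m" "?c m < ?c y'"
    by linarith
  then show ?case
  proof cases
    case 1
    then show ?thesis
      using less.hyps[of y' m] m less.prems by auto
  next
    case 2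
    then show ?thesis
      using less.hyps[of m x'] m less.prems by auto
  next
    case 3
    then show ?thesis
      using m by (intro exI[of _ "?c m"]) (simp add: collapsed_adjI)
  qed
qed

text \<open>Since \<open>collapse\<close> is monotone, a crossing of collapsed edges lifts to a
  crossing of preimages. Assumption \<open>ln\<close> leaves at least two vertices, so the root edge
  does not become a loop.\<close>

lemma polygon_triangulation_collapsed:
  assumes il: "i + l < n" and ln: "l + 2 \<le> n"
  shows "polygon_triangulation (n - l) (collapsed_adj adj i l)"
proof
  let ?c = "collapse i l"
  show "collapsed_adj adj i l x y \<Longrightarrow> x < n - l" for x y
    using adj_less il by (force simp: collapsed_adj_def collapse_def split: if_splits)
  show "collapsed_adj adj i l x y \<Longrightarrow> collapsed_adj adj i l y x" for x y
    using adj_sym unfolding collapsed_adj_def by blast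
  show "\<not> collapsed_adj adj i l x x" for x
    by (simp add: collapsed_adj_def)
  show "collapsed_adj adj i l x (Suc x)" if "Suc x < n - l" for x
  proof (cases "x < i")
    case True
    then have "adj x (Suc x)" "?c x = x" "?c (Suc x) = Suc x"
      using adj_Suc[of x] il by (auto simp: collapse_def)
    then show ?thesis
      unfolding collapsed_adj_def by (metis n_not_Suc_n)
  next
    case False
    \<comment> \<open>From \<open>i\<close> on, \<open>x + l\<close> is the last preimage of
      \<open>x\<close>, so its successor lies over \<open>Suc x\<close>.\<close>
    then have "adj (x + l) (Suc (x + l))" "?c (x + l) = x" "?c (Suc (x + l)) = Suc x"
      using adj_Suc[of "x + l"] that by (auto simp: collapse_def)
    then show ?thesis
      unfolding collapsed_adj_def by (metis n_not_Suc_n)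
  qed
  have "?c 0 = 0" "?c (n - 1) = n - l - 1"
    using il by (auto simp: collapse_def)
  then show "collapsed_adj adj i l 0 (n - l - 1)"
    using adj_root ln unfolding collapsed_adj_def by fastforce
  show False if ab: "collapsed_adj adj i l a b" and cd: "collapsed_adj adj i l c d"
    and less: "a < c" "c < b" "b < d" for a b c d
  proof -
    obtain a' b' where ab': "adj a' b'" "?c a' = a" "?c b' = b"
      using ab unfolding collapsed_adj_def by blast
    obtain c' d' where cd': "adj c' d'" "?c c' = c" "?c d' = d"
      using cd unfolding collapsed_adj_def by blast
    show False
      using noncrossing[OF ab'(1) cd'(1)] less ab' cd' collapse_less_imp_less by blast
  qed
  show "\<exists>m. x < m \<and> m < y \<and> collapsed_adj adj i l x m \<and> collapsed_adj adj i l m y"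
    if "collapsed_adj adj i l x y" "Suc x < y" for x y
    using that collapsed_apex unfolding collapsed_adj_def by blast
qed

section \<open>Separation by an edge and lifting of isolating sets\<close>

lemma adj_interior:
  assumes "adj i j" "i < x" "x < j" "adj x y"
  shows "i \<le> y" "y \<le> j"
  using noncrossing[OF assms(1,4,2,3)] noncrossing[OF adj_sym[OF assms(4)] assms(1) _ assms(2,3)]
  by (meson not_le)+

text \<open>A path of undominated vertices avoids the dominated ends \<open>i\<close> and
  \<open>j\<close>, and without them it cannot change sides.\<close>

lemma isolates_splitI:
  assumes ij: "adj i j" "i < j"
    and dom: "\<not> undominated adj S i" "\<not> undominated adj S j"
    and inner: "isolates adj {i<..<j} S"
    and outer: "isolates adj (- {i..j}) S"
  shows "isolates adj UNIV S"
  unfolding isolates_def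
proof (intro ballI impI notI)
  fix u v w
  assume P: "adj u v" "adj v w" "u \<noteq> w"
    and und: "undominated adj S u" "undominated adj S v" "undominated adj S w"
  have ends: "x \<noteq> i \<and> x \<noteq> j" if "undominated adj S x" for x
    using that dom by auto
  have side: "y \<in> {i<..<j}"
    if "adj x y" "undominated adj S y" "x \<in> {i<..<j}" for x y
    using adj_interior[OF ij(1) _ _ that(1)] that(3) ends[OF that(2)] by (auto simp: less_le)
  have same_side: "x \<in> {i<..<j} \<longleftrightarrow> y \<in> {i<..<j}"
    if "adj x y" "undominated adj S x" "undominated adj S y" for x y
    using side that adj_sym by blast
  show False
  proof (cases "v \<in> {i<..<j}")
    case True
    then have "{u, v, w} \<subseteq> {i<..<j}"
      using same_side P und by blast
    then show False
      using inner P und by (auto simp: isolates_def)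
  next
    case False
    then have "x \<in> - {i..j}" if "x \<in> {u, v, w}" for x
    proof -
      have "x \<notin> {i<..<j}" "x \<noteq> i" "x \<noteq> j"
        using that False same_side P und ends by blast+
      then show ?thesis
        by auto
    qed
    then show False
      using outer P und unfolding isolates_def by blast
  qed
qed

text \<open>The interval collapsed to \<open>i\<close> includes \<open>j\<close> if \<open>l = j - i\<close>. In this case both \<open>i\<close> and \<open>j\<close> lie
  over a chosen vertex \<open>i \<in> S'\<close>, which costs nothing extra as one of them is in \<open>X\<close> already.\<close>

lemma isolating_extend:
  assumes ij: "adj i j" "i < j"
    and l: "l = j - i \<and> (i \<in> X \<or> j \<in> X) \<or> l = j - i - 1"
    and S': "isolates (collapsed_adj adj i l) UNIV S'" "finite S'"
    and X: "X \<subseteq> {..<n}" "\<not> undominated adj X i" "\<not> undominated adj X j"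
    and inner: "isolates adj {i<..<j} X"
  shows "\<exists>S\<subseteq>{..<n}. isolates adj UNIV S \<and> card S \<le> card X + card S'"
proof -
  let ?c = "collapse i l"
  \<comment> \<open>The part of the preimage of \<open>S'\<close> that is added to \<open>X\<close>.
    Subtracting \<open>X\<close> ensures that \<open>i\<close> and \<open>j\<close> are not both
    counted when they are identified.\<close>
  define Y where "Y = {x. x < n \<and> x \<notin> {i<..<j} \<and> ?c x \<in> S'} - X"
  have und_X: "undominated adj X x" if "undominated adj (X \<union> Y) x" for x
    using that by (auto simp: undominated_def)
  have fibre: "x = u" if "?c x = ?c u" "u \<notin> {i..j}" for x u
    using that l ij(2) by (auto simp: collapse_def split: if_splits)
  have und_c: "undominated (collapsed_adj adj i l) S' (?c u)"
    if u: "u \<notin> {i..j}" "u < n" "undominated adj (X \<union> Y) u" for u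
    unfolding undominated_def
  proof (intro conjI ballI notI)
    assume "?c u \<in> S'"
    then have "u \<in> X \<union> Y"
      using u by (auto simp: Y_def)
    then show False
      using u(3) by (simp add: undominated_def)
  next
    fix s assume s: "s \<in> S'" "collapsed_adj adj i l s (?c u)"
    then obtain x y where xy: "adj x y" "?c x = s" "?c y = ?c u"
      by (auto simp: collapsed_adj_def)
    \<comment> \<open>Outside \<open>{i..j}\<close> fibres are singletons, so the edge over the
      collapsed one really ends in \<open>u\<close>. Its other end is then not interior and hence
      belongs to \<open>X \<union> Y\<close>.\<close>
    then have "adj x u"
      using fibre u(1) by metis
    then have "x \<notin> {i<..<j}"
      using adj_interior[OF ij(1), of x u] u(1) by auto
    then have "x \<in> X \<union> Y"
      using xy s(1) adj_less by (auto simp: Y_def)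
    then show False
      using u(3) \<open>adj x u\<close> by (auto simp: undominated_def)
  qed
  have "isolates adj UNIV (X \<union> Y)"
  proof (rule isolates_splitI[OF ij])
    show "\<not> undominated adj (X \<union> Y) i" "\<not> undominated adj (X \<union> Y) j"
      using X und_X by blast+
    show "isolates adj {i<..<j} (X \<union> Y)"
      using inner und_X unfolding isolates_def by blast
    show "isolates adj (- {i..j}) (X \<union> Y)"
      unfolding isolates_def
    proof (intro ballI impI notI)
      fix u v w
      assume out: "u \<in> - {i..j}" "v \<in> - {i..j}" "w \<in> - {i..j}"
        and P: "adj u v" "adj v w" "u \<noteq> w"
        and und: "undominated adj (X \<union> Y) u" "undominated adj (X \<union> Y) v"
          "undominated adj (X \<union> Y) w"
      have lt: "u < n" "v < n" "w < n"
        using P adj_less adj_sym by blast+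
      have ne: "u \<noteq> v" "v \<noteq> w"
        using P adj_irrefl by blast+
      have "?c u \<noteq> ?c v" "?c v \<noteq> ?c w" "?c u \<noteq> ?c w"
        using fibre out ne P(3) by blast+
      then have "collapsed_adj adj i l (?c u) (?c v)" "collapsed_adj adj i l (?c v) (?c w)"
        using P by (simp_all add: collapsed_adjI)
      moreover have "undominated (collapsed_adj adj i l) S' (?c u)"
        "undominated (collapsed_adj adj i l) S' (?c v)"
        "undominated (collapsed_adj adj i l) S' (?c w)"
        using und_c out lt und by blast+
      ultimately show False
        using S'(1) \<open>?c u \<noteq> ?c w\<close> unfolding isolates_def by blast
    qed
  qed
  moreover have "X \<union> Y \<subseteq> {..<n}"
    using X(1) by (auto simp: Y_def)
  moreover have "card (X \<union> Y) \<le> card X + card S'"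
  proof -
    have c_Y: "x \<le> i \<and> ?c x = x \<or> j \<le> x \<and> ?c x = x - l" if "x \<in> Y" for x
      using that l ij(2) by (auto simp: Y_def collapse_def)
    \<comment> \<open>Two elements of \<open>Y\<close> could share an image only if they are
      \<open>i\<close> and \<open>j\<close> and \<open>l = j - i\<close>; in that case one of them
      is in \<open>X\<close>.\<close>
    have *: "l < j - i \<or> i \<notin> Y \<or> j \<notin> Y"
      using l ij(2) by (auto simp: Y_def)
    have "inj_on ?c Y"
    proof (rule linorder_inj_onI)
      fix x y assume xy: "x < y" "x \<in> Y" "y \<in> Y"
      have "x \<le> i \<and> j \<le> y \<longrightarrow> x = i \<and> y = j \<and> l = j - i" if "x = y - l"
        using that l ij(2) by auto
      then show "?c x \<noteq> ?c y"
        using c_Y[OF xy(2)] c_Y[OF xy(3)] * xy l ij(2) by auto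
    qed auto
    moreover have "?c ` Y \<subseteq> S'"
      by (auto simp: Y_def)
    ultimately have "card Y \<le> card S'"
      using S'(2) by (metis card_image card_mono)
    then show ?thesis
      using card_Un_le[of X Y] by linarith
  qed
  ultimately show ?thesis
    by blast
qed

section \<open>Local structure at a shortest edge of span at least 5\<close>

text \<open>The root edge is a candidate because \<open>n - 1 \<ge> 5\<close>. The edges
  \<open>it\<close> and \<open>tj\<close> are shorter than the minimal span \<open>k\<close>, so
  they span at most 4.\<close>

lemma short_edge:
  assumes "6 \<le> n"
  obtains i t j where "i < t" "t < j" "adj i j" "adj i t" "adj t j"
    "i + 5 \<le> j" "t \<le> i + 4" "j \<le> t + 4"
proof -
  define P where "P k \<longleftrightarrow> 5 \<le> k \<and> (\<exists>i. adj i (i + k))" for k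
  have ex: "P (n - 1)"
    using assms adj_root by (auto simp: P_def intro: exI[of _ 0])
  define k where "k = (LEAST k. P k)"
  have "P k"
    unfolding k_def using ex by (rule LeastI)
  then obtain i where i: "5 \<le> k" "adj i (i + k)"
    by (auto simp: P_def)
  have small: "b < a + 5" if "adj a b" "a < b" "b < a + k" for a b
  proof (rule ccontr)
    assume "\<not> b < a + 5"
    then have "P (b - a)"
      using that by (auto simp: P_def intro: exI[of _ a])
    then have "k \<le> b - a"
      unfolding k_def by (rule Least_le)
    then show False
      using that by simp
  qed
  obtain t where t: "i < t" "t < i + k" "adj i t" "adj t (i + k)"
    using apex[OF i(2)] i(1) by auto
  show thesis
    using that[of i t "i + k"] i t small[of i t] small[of t "i + k"] by auto
qed

text \<open>The edges \<open>it\<close> and \<open>tj\<close> keep an undominated path on one side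
  of \<open>t\<close>, where too few undominated vertices remain.\<close>

lemma apex_isolates_interior:
  assumes "adj i t" "adj t j" "i < t" "t < j" "t \<le> i + 4" "j \<le> t + 4"
  shows "isolates adj {i<..<j} {t}"
  unfolding isolates_def
proof (intro ballI impI notI)
  fix u v w
  assume in_ij: "u \<in> {i<..<j}" "v \<in> {i<..<j}" "w \<in> {i<..<j}"
    and uvw: "adj u v" "adj v w" "u \<noteq> w"
    and und: "undominated adj {t} u" "undominated adj {t} v" "undominated adj {t} w"
  have "t < n" "j < n"
    using assms adj_less adj_sym by blast+
  then have near: "adj t (t - 1)" "adj t (Suc t)"
    using adj_Suc[of "t - 1"] adj_Suc[of t] adj_sym assms(3,4) by auto
  have far: "x \<noteq> t \<and> x \<noteq> t - 1 \<and> x \<noteq> Suc t" if "undominated adj {t} x" for x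
    using that near by (auto simp: undominated_def)
  have left: "y < t" if "adj x y" "x \<in> {i<..<t}" "undominated adj {t} y" for x y
    using adj_interior[OF assms(1), of x y] far[OF that(3)] that by auto
  have right: "y > t" if "adj x y" "x \<in> {t<..<j}" "undominated adj {t} y" for x y
    using adj_interior[OF assms(2), of x y] far[OF that(3)] that by auto
  have ne: "u \<noteq> v" "v \<noteq> w"
    using uvw adj_irrefl by blast+
  have vu: "adj v u"
    using uvw adj_sym by blast
  consider "v < t" | "t < v"
    using far[OF und(2)] by linarith
  then show False
  proof cases
    case 1
    then have "u < t" "w < t"
      using left[OF vu _ und(1)] left[OF uvw(2) _ und(3)] in_ij by auto
    \<comment> \<open>At most three vertices lie strictly between \<open>i\<close> and
      \<open>t\<close>, and \<open>t\<close> dominates its boundary neighbour among them.\<close>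
    then have "{u, v, w} \<subseteq> {i + 1, i + 2}"
      using 1 far[OF und(1)] far[OF und(2)] far[OF und(3)] in_ij assms(5) by auto
    then show False
      using ne uvw(3) by auto
  next
    case 2
    then have "t < u" "t < w"
      using right[OF vu _ und(1)] right[OF uvw(2) _ und(3)] in_ij by auto
    then have "{u, v, w} \<subseteq> {t + 2, t + 3}"
      using 2 far[OF und(1)] far[OF und(2)] far[OF und(3)] in_ij assms(6) by auto
    then show False
      using ne uvw(3) by auto
  qed
qed

lemma isolates_if_few_undominated:
  assumes "\<And>x. \<lbrakk>x \<in> A; x < n; undominated adj S x\<rbrakk> \<Longrightarrow> x \<in> B" "finite B" "card B \<le> 2"
  shows "isolates adj A S"
  unfolding isolates_def
proof (intro ballI impI notI)
  fix u v w
  assume A: "u \<in> A" "v \<in> A" "w \<in> A" and P: "adj u v" "adj v w" "u \<noteq> w"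
    and und: "undominated adj S u" "undominated adj S v" "undominated adj S w"
  have "u < n" "v < n" "w < n"
    using P adj_less adj_sym by blast+
  then have "u \<in> B" "v \<in> B" "w \<in> B"
    using assms(1) A und by blast+
  moreover have "u \<noteq> v" "v \<noteq> w"
    using P adj_irrefl by blast+
  ultimately show False
    using three_distinct_le_card[of B u v w] assms(2,3) P(3) by linarith
qed

lemma card_outside:
  assumes "i \<le> j" "j < n"
  shows "card {x. x < n \<and> x \<notin> {i..j}} = n - Suc (j - i)"
proof -
  have "{x. x < n \<and> x \<notin> {i..j}} = {..<n} - {i..j}"
    by auto
  moreover have "{i..j} \<subseteq> {..<n}"
    using assms by auto
  ultimately show ?thesis
    using assms by (simp add: card_Diff_subset Suc_diff_le)
qed

text \<open>Both ends dominate \<open>t\<close>, and each also dominates its boundary neighbour in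
  the interval. An end whose neighbour is not \<open>t\<close> therefore leaves only two of the four
  interior vertices.\<close>

lemma end_isolates_interior:
  assumes "adj i j" "adj i t" "adj t j" "i < t" "t < j" "j = i + 5"
  obtains x where "x = i \<or> x = j" "isolates adj {i<..<j} {x}"
proof -
  have "j < n"
    using assms adj_less adj_sym by blast
  then have near: "adj i (Suc i)" "adj j (j - 1)"
    using adj_Suc[of i] adj_sym[OF adj_Suc[of "j - 1"]] assms(6) by (auto simp: add.commute)
  have "\<exists>x y. (x = i \<or> x = j) \<and> y \<in> {i<..<j} \<and> y \<noteq> t \<and> adj x y"
  proof (cases "t = j - 1")
    case True
    then show ?thesis
      using near assms by (intro exI[of _ i] exI[of _ "Suc i"]) auto
  next
    case False
    then show ?thesis
      using near assms by (intro exI[of _ j] exI[of _ "j - 1"]) auto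
  qed
  then obtain x y where xy: "x = i \<or> x = j" "y \<in> {i<..<j}" "y \<noteq> t" "adj x y"
    by blast
  have "adj x t"
    using xy(1) assms adj_sym by blast
  have "card ({i<..<j} - {t, y}) = 2"
    using xy assms by (subst card_Diff_subset) auto
  then have "isolates adj {i<..<j} {x}"
    using \<open>adj x t\<close> xy(4)
    by (intro isolates_if_few_undominated[of _ _ "{i<..<j} - {t, y}"]) (auto simp: undominated_def)
  then show thesis
    using that xy(1) by blast
qed

text \<open>The neighbour is the next vertex of the boundary cycle; the root edge supplies it when
  \<open>x\<close> is 0 or \<open>n - 1\<close>. It handles polygons too small for the
  induction.\<close>

lemma outside_neighbour:
  assumes "i < j" "adj i j" "x = i \<or> x = j" "j - i + 1 < n"
  obtains y where "y < n" "y \<notin> {i..j}" "adj x y"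
proof -
  have "j < n"
    using assms adj_less adj_sym by blast
  show thesis
  proof (cases "x = i")
    case True
    show thesis
    proof (cases "i = 0")
      case True
      then show thesis
        using that[of "n - 1"] adj_root \<open>x = i\<close> assms \<open>j < n\<close> by auto
    next
      case False
      then show thesis
        using that[of "i - 1"] adj_Suc[of "i - 1"] adj_sym \<open>x = i\<close> assms \<open>j < n\<close> by auto
    qed
  next
    case False
    then have [simp]: "x = j"
      using assms by simp
    show thesis
    proof (cases "j = n - 1")
      case True
      then show thesis
        using that[of 0] adj_root adj_sym assms \<open>j < n\<close> by auto
    next
      case False
      then show thesis
        using that[of "Suc j"] adj_Suc[of j] assms \<open>j < n\<close> by auto
    qed
  qed
qed

end

section \<open>Induction on the number of vertices\<close>

theorem polygon_triangulation_isolating_set: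
  assumes "polygon_triangulation n adj" "5 \<le> n"
  shows "\<exists>S\<subseteq>{..<n}. isolates adj UNIV S \<and> 5 * card S \<le> n"
  using assms
proof (induction n arbitrary: adj rule: less_induct)
  case (less n)
  interpret polygon_triangulation n adj
    by (rule less.prems)
  \<comment> \<open>The reduction: the single vertex of \<open>X\<close> pays for the
    \<open>l \<ge> 5\<close> vertices lost, and \<open>5 \<le> n - l\<close> makes the induction
    hypothesis available.\<close>
  have lift: ?case
    if ij: "adj i j" "i < j"
      and l: "l = j - i \<and> (i \<in> X \<or> j \<in> X) \<or> l = j - i - 1" "5 \<le> l" "5 \<le> n - l"
      and X: "X \<subseteq> {..<n}" "card X = 1" "\<not> undominated adj X i" "\<not> undominated adj X j"
      and inner: "isolates adj {i<..<j} X"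
    for i j l X
  proof -
    have "j < n"
      using ij adj_less adj_sym by blast
    then have "polygon_triangulation (n - l) (collapsed_adj adj i l)"
      using l ij(2) by (intro polygon_triangulation_collapsed) auto
    then obtain S' where S': "S' \<subseteq> {..<n - l}" "isolates (collapsed_adj adj i l) UNIV S'"
      "5 * card S' \<le> n - l"
      using less.IH[of "n - l"] l(2,3) by auto
    have "finite S'"
      using S'(1) finite_subset by blast
    then obtain S where "S \<subseteq> {..<n}" "isolates adj UNIV S" "card S \<le> card X + card S'"
      using isolating_extend[OF ij l(1) S'(2) _ X(1,3,4) inner] by blast
    then show ?case
      using S'(3) X(2) l(2,3) by (intro exI[of _ S]) auto
  qed
  show ?case
  proof (cases "n = 5")
    case True
    have "adj 0 1" "adj 0 4"
      using adj_Suc[of 0] adj_root True by auto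
    then have und: "x = 2 \<or> x = 3" if "undominated adj {0} x" "x < n" for x
    proof -
      have "x \<noteq> 0" "x \<noteq> 1" "x \<noteq> 4"
        using that(1) \<open>adj 0 1\<close> \<open>adj 0 4\<close> by (auto simp: undominated_def)
      then show ?thesis
        using that(2) True by linarith
    qed
    have "isolates adj UNIV {0}"
      by (rule isolates_if_few_undominated[of _ _ "{2, 3}"]) (use und in auto)
    then show ?thesis
      using True by (intro exI[of _ "{0}"]) auto
  next
    case False
    obtain i t j where *: "i < t" "t < j" "adj i j" "adj i t" "adj t j"
      and bounds: "i + 5 \<le> j" "t \<le> i + 4" "j \<le> t + 4"
      by (rule short_edge) (use False less.prems(2) in linarith)
    have "i < j"
      using * by linarith
    have lt: "i < n" "t < n" "j < n"
      using * adj_less adj_sym by blast+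
    show ?thesis
    proof (cases "j = i + 5")
      case True
      then obtain x where x: "x = i \<or> x = j"
        and inner: "isolates adj {i<..<j} {x}"
        using end_isolates_interior[OF *(3-5,1,2)] by blast
      have X: "{x} \<subseteq> {..<n}" "\<not> undominated adj {x} i" "\<not> undominated adj {x} j"
        using x lt *(3) adj_sym by (auto simp: undominated_def)
      show ?thesis
      \<comment> \<open>Contracting with \<open>l = 5\<close> leaves at least 5 vertices only if
        \<open>n \<ge> 10\<close>; for \<open>n\<close> from 6 to 9 the vertex \<open>x\<close>
        alone must suffice.\<close>
      proof (cases "10 \<le> n")
        case True
        then show ?thesis
          by (intro lift[OF *(3) \<open>i < j\<close> _ _ _ X(1) _ X(2,3) inner, of 5])
            (use x \<open>j = i + 5\<close> in auto)
      next
        case False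
        let ?O = "{x. x < n \<and> x \<notin> {i..j}}"
        let ?U = "{y. y < n \<and> y \<notin> {i..j} \<and> undominated adj {x} y}"
        have cO: "card ?O = n - 6"
          using card_outside[of i j] lt \<open>i < j\<close> True by simp
        have "card ?U \<le> 2"
        \<comment> \<open>At most three vertices lie outside \<open>{i..j}\<close>, and
          \<open>x\<close> dominates one of them unless there are none at all, that is
          \<open>n = 6\<close>.\<close>
        proof (cases "n = 6")
          case True
          have "card ?U \<le> card ?O"
            by (intro card_mono) auto
          then show ?thesis
            using cO True by linarith
        next
          case False
          then obtain y where y: "y < n" "y \<notin> {i..j}" "adj x y"
            using outside_neighbour[OF \<open>i < j\<close> *(3) x] True less.prems(2) \<open>n \<noteq> 5\<close> by auto
          have "card ?U \<le> card (?O - {y})"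
            using y by (intro card_mono) (auto simp: undominated_def)
          also have "\<dots> = n - 7"
            using y cO by simp
          finally show ?thesis
            using \<open>\<not> 10 \<le> n\<close> by simp
        qed
        then have "isolates adj (- {i..j}) {x}"
          by (intro isolates_if_few_undominated[of _ _ ?U]) auto
        then have "isolates adj UNIV {x}"
          by (rule isolates_splitI[OF *(3) \<open>i < j\<close> X(2,3) inner])
        then show ?thesis
          using X(1) less.prems(2) by (intro exI[of _ "{x}"]) auto
      qed
    next
      case False
      then have six: "i + 6 \<le> j"
        using bounds by linarith
      have X: "{t} \<subseteq> {..<n}" "\<not> undominated adj {t} i" "\<not> undominated adj {t} j"
        using lt * adj_sym by (auto simp: undominated_def)
      note inner = apex_isolates_interior[OF *(4,5,1,2) bounds(2,3)]
      show ?thesis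
      proof (cases "5 \<le> n - (j - i - 1)")
        case True
        show ?thesis
          by (rule lift[OF *(3) \<open>i < j\<close> _ _ True X(1) _ X(2,3) inner]) (use six in auto)
      next
        case False
        \<comment> \<open>The outside consists of \<open>n - (j - i - 1) - 2\<close> vertices, and
          here \<open>n - (j - i - 1) \<le> 4\<close>.\<close>
        have "card {x. x < n \<and> x \<notin> {i..j}} \<le> 2"
          using card_outside[of i j] lt \<open>i < j\<close> False by simp
        then have "isolates adj (- {i..j}) {t}"
          by (intro isolates_if_few_undominated[of _ _ "{x. x < n \<and> x \<notin> {i..j}}"]) auto
        then have "isolates adj UNIV {t}"
          by (rule isolates_splitI[OF *(3) \<open>i < j\<close> X(2,3) inner])
        then show ?thesis
          using X(1) less.prems(2) by (intro exI[of _ "{t}"]) auto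
      qed
    qed
  qed
qed

section \<open>Plane drawings\<close>

definition walk_edges :: "(nat \<Rightarrow> 'a) \<Rightarrow> nat \<Rightarrow> nat \<Rightarrow> 'a set set" where
  "walk_edges v i j = (\<lambda>k. {v k, v (Suc k)}) ` {i..<j}"

lemma Union_walk_edges:
  assumes "i < j"
  shows "\<Union> (walk_edges v i j) = v ` {i..j}"
proof
  show "\<Union> (walk_edges v i j) \<subseteq> v ` {i..j}"
    by (auto simp: walk_edges_def)
  show "v ` {i..j} \<subseteq> \<Union> (walk_edges v i j)"
  proof (rule image_subsetI)
    fix k assume k: "k \<in> {i..j}"
    show "v k \<in> \<Union> (walk_edges v i j)"
    proof (cases "k = j")
      case True
      then show ?thesis
        using assms by (auto simp: walk_edges_def intro!: bexI[of _ "j - 1"])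
    next
      case False
      then show ?thesis
        using k by (auto simp: walk_edges_def intro!: bexI[of _ k])
    qed
  qed
qed

lemma walk_edges_Suc: "i \<le> j \<Longrightarrow> walk_edges v i (Suc j) = insert {v j, v (Suc j)} (walk_edges v i j)"
  by (simp add: walk_edges_def atLeastLessThanSuc)

lemma chord_notin_walk_edges:
  assumes "inj_on v {i..j}" "i + 2 \<le> j"
  shows "{v i, v j} \<notin> walk_edges v i j"
proof
  assume "{v i, v j} \<in> walk_edges v i j"
  then obtain k where k: "i \<le> k" "k < j" "{v i, v j} = {v k, v (Suc k)}"
    by (auto simp: walk_edges_def)
  then have "v ` {i, j} = v ` {k, Suc k}"
    by simp
  then have "{i, j} = {k, Suc k}"
    using inj_on_image_eq_iff[OF assms(1), of "{i, j}" "{k, Suc k}"] k assms(2) by auto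
  then show False
    using assms(2) by (auto simp: doubleton_eq_iff)
qed

text \<open>Continuity transfers the fact that \<open>{0..1}\<close> is the closure of its interior.
  This puts the ends of an edge into the closure of any region containing the open edge.\<close>

lemma path_image_subset_closure_endless:
  assumes "simple_path g"
  shows "path_image g \<subseteq> closure (path_image g - {pathstart g, pathfinish g})"
proof -
  have "g ` closure {0<..<1} \<subseteq> closure (g ` {0<..<1})"
    using assms by (intro image_closure_subset closure_subset) (auto simp: simple_path_def path_def)
  then show ?thesis
    using simple_path_endless[OF assms] by (simp add: path_image_def)
qed

lemma cycle_edges_triangle: "cycle_edges [x, y, z] = {{x, y}, {y, z}, {z, x}}"
proof -
  have "{..<length [x, y, z]} = {0, 1, 2}"
    by auto
  then show ?thesis
    by (simp add: cycle_edges_def)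
qed

section \<open>Curves drawn by sets of edges\<close>

locale plane_graph =
  fixes V :: "'a set" and E :: "'a set set"
    and pos :: "'a \<Rightarrow> complex" and \<gamma> :: "'a set \<Rightarrow> real \<Rightarrow> complex"
  assumes graph: "simple_graph V E" and embedding: "plane_embedding V E pos \<gamma>"
begin

definition curve :: "'a set set \<Rightarrow> complex set" where
  "curve A = (\<Union>e\<in>A. path_image (\<gamma> e))"

lemma edge_subset: "e \<in> E \<Longrightarrow> e \<subseteq> V" and card_edge: "e \<in> E \<Longrightarrow> card e = 2"
  using graph by (auto simp: simple_graph_def)

lemma inj_pos: "inj_on pos V"
  using embedding by (simp add: plane_embedding_def)

lemma arc_edge: "e \<in> E \<Longrightarrow> arc (\<gamma> e)"
  and ends_edge: "e \<in> E \<Longrightarrow> {pathstart (\<gamma> e), pathfinish (\<gamma> e)} = pos ` e"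
  and edge_Int_vertices: "e \<in> E \<Longrightarrow> path_image (\<gamma> e) \<inter> pos ` V = pos ` e"
  using embedding by (simp_all add: plane_embedding_def)

lemma edge_Int_edge:
  "\<lbrakk>e \<in> E; f \<in> E; e \<noteq> f\<rbrakk> \<Longrightarrow> path_image (\<gamma> e) \<inter> path_image (\<gamma> f) = pos ` (e \<inter> f)"
  using embedding by (simp add: plane_embedding_def)

lemma finite_V: "finite V"
  using graph by (simp add: simple_graph_def)

lemma finite_E: "finite E"
  using finite_V edge_subset by (meson PowI finite_Pow_iff finite_subset subsetI)

lemma compact_curve: "A \<subseteq> E \<Longrightarrow> compact (curve A)"
  unfolding curve_def using finite_E arc_edge
  by (intro compact_UN) (auto intro: finite_subset compact_arc_image)

lemma curve_Un: "curve (A \<union> B) = curve A \<union> curve B"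
  by (auto simp: curve_def)

lemma curve_insert: "curve (insert e A) = path_image (\<gamma> e) \<union> curve A"
  by (auto simp: curve_def)

lemma pos_in_curve_iff:
  assumes "A \<subseteq> E" "u \<in> V"
  shows "pos u \<in> curve A \<longleftrightarrow> u \<in> \<Union>A"
proof
  assume "pos u \<in> curve A"
  then obtain e where e: "e \<in> A" "pos u \<in> path_image (\<gamma> e)"
    by (auto simp: curve_def)
  then have "pos u \<in> pos ` e"
    using edge_Int_vertices[of e] assms by blast
  then have "u \<in> e"
    using inj_on_image_mem_iff[OF inj_pos assms(2)] edge_subset e(1) assms(1) by blast
  then show "u \<in> \<Union>A"
    using e(1) by blast
next
  assume "u \<in> \<Union>A"
  then show "pos u \<in> curve A"
    using edge_Int_vertices assms by (fastforce simp: curve_def)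
qed

text \<open>Reduces intersections of curves to the combinatorics of their end vertices.\<close>

lemma curve_Int_curve:
  assumes "A \<subseteq> E" "B \<subseteq> E" "A \<inter> B = {}"
  shows "curve A \<inter> curve B = pos ` (\<Union>A \<inter> \<Union>B)"
proof
  show "curve A \<inter> curve B \<subseteq> pos ` (\<Union>A \<inter> \<Union>B)"
  proof
    fix x assume "x \<in> curve A \<inter> curve B"
    then obtain e f where ef: "e \<in> A" "f \<in> B" "x \<in> path_image (\<gamma> e) \<inter> path_image (\<gamma> f)"
      by (auto simp: curve_def)
    then have "x \<in> pos ` (e \<inter> f)"
      using edge_Int_edge[of e f] assms by blast
    then show "x \<in> pos ` (\<Union>A \<inter> \<Union>B)"
      using ef by blast
  qed
  show "pos ` (\<Union>A \<inter> \<Union>B) \<subseteq> curve A \<inter> curve B"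
    using pos_in_curve_iff assms edge_subset by blast
qed

lemma oriented_edge_arc:
  assumes "{u, w} \<in> E"
  obtains g where "arc g" "pathstart g = pos u" "pathfinish g = pos w"
    "path_image g = path_image (\<gamma> {u, w})"
proof (cases "pathstart (\<gamma> {u, w}) = pos u \<and> pathfinish (\<gamma> {u, w}) = pos w")
  case True
  then show thesis
    using that arc_edge[OF assms] by blast
next
  case False
  then have "pathstart (\<gamma> {u, w}) = pos w" "pathfinish (\<gamma> {u, w}) = pos u"
    using ends_edge[OF assms] by (auto simp: doubleton_eq_iff)
  then show thesis
    using that[of "reversepath (\<gamma> {u, w})"] arc_edge[OF assms] by (simp add: arc_reversepath)
qed

text \<open>Edges are appended one at a time: the new vertex is not on the walk so far, so the new
  edge meets it in \<open>v j\<close> alone and the join is again an arc.\<close>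

lemma walk_arc:
  assumes "i < j" "inj_on v {i..j}" "walk_edges v i j \<subseteq> E"
  shows "\<exists>g. arc g \<and> pathstart g = pos (v i) \<and> pathfinish g = pos (v j) \<and>
    path_image g = curve (walk_edges v i j)"
  \<comment> \<open>The induction starts at a single edge, since a constant path is not an
    arc.\<close>
  using Suc_leI[OF assms(1)] assms(2,3)
proof (induction j rule: dec_induct)
  case base
  then have "{v i, v (Suc i)} \<in> E"
    by (simp add: walk_edges_def)
  then obtain g where "arc g" "pathstart g = pos (v i)" "pathfinish g = pos (v (Suc i))"
    "path_image g = path_image (\<gamma> {v i, v (Suc i)})"
    using oriented_edge_arc by blast
  then show ?case
    by (intro exI[of _ g]) (simp add: curve_def walk_edges_def)
next
  case (step j)
  let ?e = "{v j, v (Suc j)}"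
  have W: "walk_edges v i (Suc j) = insert ?e (walk_edges v i j)"
    using step.hyps by (simp add: walk_edges_Suc)
  have sub: "walk_edges v i j \<subseteq> E" "?e \<in> E"
    using step.prems W by auto
  have "inj_on v {i..j}"
    using step.prems(1) by (rule inj_on_subset) auto
  then obtain g where g: "arc g" "pathstart g = pos (v i)" "pathfinish g = pos (v j)"
    "path_image g = curve (walk_edges v i j)"
    using step.IH sub by blast
  obtain h where h: "arc h" "pathstart h = pos (v j)" "pathfinish h = pos (v (Suc j))"
    "path_image h = path_image (\<gamma> ?e)"
    using oriented_edge_arc[OF sub(2)] by blast
  have new: "v (Suc j) \<notin> v ` {i..j}"
    using step.prems(1) step.hyps by (auto dest: inj_onD)
  have U: "\<Union> (walk_edges v i j) = v ` {i..j}"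
    using step.hyps by (intro Union_walk_edges) auto
  have "?e \<notin> walk_edges v i j"
    using new U by blast
  then have *: "curve (walk_edges v i j) \<inter> curve {?e} = pos ` (v ` {i..j} \<inter> ?e)"
    using curve_Int_curve[of "walk_edges v i j" "{?e}"] sub U by simp
  have "path_image g \<inter> path_image h \<subseteq> {pathstart h}"
  proof -
    have "v ` {i..j} \<inter> ?e \<subseteq> {v j}"
      using new by (simp add: Int_insert_right)
    then have "pos ` (v ` {i..j} \<inter> ?e) \<subseteq> pos ` {v j}"
      by (rule image_mono)
    moreover have "path_image g \<inter> path_image h = pos ` (v ` {i..j} \<inter> ?e)"
      unfolding *[symmetric] by (simp add: g(4) h(4) curve_def)
    ultimately show ?thesis
      by (simp only: h(2) image_insert image_empty)
  qed
  then have "arc (g +++ h)"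
    using g h by (intro arc_join) auto
  moreover have "path_image (g +++ h) = curve (walk_edges v i (Suc j))"
    using g h W by (simp add: path_image_join curve_insert Un_commute)
  ultimately show ?case
    using g h by (intro exI[of _ "g +++ h"]) simp
qed

lemma drawing_eq: "drawing V E pos \<gamma> = pos ` V \<union> curve E"
  by (simp add: drawing_def curve_def)

lemma compact_drawing: "compact (drawing V E pos \<gamma>)"
  using compact_curve[of E] finite_V by (auto simp: drawing_eq intro: finite_imp_compact)

lemma curve_subset_drawing: "A \<subseteq> E \<Longrightarrow> curve A \<subseteq> drawing V E pos \<gamma>"
  by (auto simp: drawing_eq curve_def)

end

section \<open>The exterior face and the outer cycle\<close>

locale mop_drawing = plane_graph +
  fixes F\<^sub>0 :: "complex set" and c :: "'a list"
  assumes F0: "F\<^sub>0 \<in> faces V E pos \<gamma>" "\<not> bounded F\<^sub>0" "pos ` V \<subseteq> frontier F\<^sub>0"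
    and outer: "bounded_by_cycle V E \<gamma> F\<^sub>0 c"
    and inner: "\<And>F. \<lbrakk>F \<in> faces V E pos \<gamma>; bounded F\<rbrakk> \<Longrightarrow>
      \<exists>t. length t = 3 \<and> bounded_by_cycle V E \<gamma> F t"
begin

abbreviation n :: nat where "n \<equiv> length c"

text \<open>Reading indices modulo \<open>n\<close> turns a boundary path past the end of the list
  into a walk over an interval, such as the one from \<open>b\<close> to
  \<open>a + n\<close>.\<close>

definition v :: "nat \<Rightarrow> 'a" where "v k = c ! (k mod n)"

lemma c_cycle: "3 \<le> n" "distinct c" "set c \<subseteq> V" "cycle_edges c \<subseteq> E"
  and frontier_F0: "frontier F\<^sub>0 = curve (cycle_edges c)"
  using outer by (auto simp: bounded_by_cycle_def is_cycle_def curve_def)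

text \<open>Every vertex is drawn on the frontier of the exterior face, and a vertex lies on a curve
  only as an end of one of its edges.\<close>

lemma cycle_vertices: "set c = V"
proof
  show "V \<subseteq> set c"
  proof
    fix u assume u: "u \<in> V"
    then have "u \<in> \<Union> (cycle_edges c)"
      using F0(3) frontier_F0 pos_in_curve_iff[OF c_cycle(4) u] by auto
    then show "u \<in> set c"
      using c_cycle(1) by (auto simp: cycle_edges_def intro!: nth_mem mod_less_divisor)
  qed
qed (rule c_cycle)

lemma v_in_V: "v k \<in> V"
proof -
  have "k mod n < n"
    using c_cycle(1) by (intro mod_less_divisor) linarith
  then show ?thesis
    using c_cycle(3) by (auto simp: v_def)
qed

lemma inj_mod: "inj_on (\<lambda>k. k mod n) {a..<a + n}"
proof (rule linorder_inj_onI)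
  fix x y assume xy: "x < y" "x \<in> {a..<a + n}" "y \<in> {a..<a + n}"
  show "x mod n \<noteq> y mod n"
  proof
    assume "x mod n = y mod n"
    then have "n dvd y - x"
      using xy(1) by (metis mod_eq_dvd_iff_nat less_imp_le)
    then have "n \<le> y - x"
      using xy(1) by (intro dvd_imp_le) auto
    then show False
      using xy by auto
  qed
qed auto

lemma inj_v: "A \<subseteq> {a..<a + n} \<Longrightarrow> inj_on v A"
proof -
  have "0 < n"
    using c_cycle(1) by linarith
  then have "inj_on v {a..<a + n}"
    using inj_mod[of a] c_cycle(2) unfolding inj_on_def v_def
    by (metis mod_less_divisor nth_eq_iff_index_eq)
  then show "A \<subseteq> {a..<a + n} \<Longrightarrow> inj_on v A"
    by (rule inj_on_subset)
qed

lemma v_plus_n: "v (k + n) = v k"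
  by (simp add: v_def)

lemma v_eq_nth: "k < n \<Longrightarrow> v k = c ! k"
  by (simp add: v_def)

lemma cycle_edges_eq_walk: "cycle_edges c = walk_edges v a (a + n)"
proof -
  have "(\<lambda>k. k mod n) ` {a..<a + n} = {..<n}"
  proof (rule card_subset_eq)
    have "0 < n"
      using c_cycle(1) by linarith
    then show "(\<lambda>k. k mod n) ` {a..<a + n} \<subseteq> {..<n}"
      by auto
  qed (simp_all add: card_image[OF inj_mod])
  then have "cycle_edges c = (\<lambda>i. {c ! i, c ! (Suc i mod n)}) ` (\<lambda>k. k mod n) ` {a..<a + n}"
    by (simp add: cycle_edges_def)
  also have "\<dots> = walk_edges v a (a + n)"
    by (simp add: walk_edges_def v_def image_image mod_Suc_eq)
  finally show ?thesis .
qed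

lemma walk_edges_subset: "j \<le> i + n \<Longrightarrow> walk_edges v i j \<subseteq> cycle_edges c"
  unfolding cycle_edges_eq_walk[of i] walk_edges_def by auto

text \<open>The exterior face is connected, unbounded and disjoint from the drawing, so it lies in
  an unbounded component of the complement of any part of the drawing.\<close>

lemma F0_subset_outside:
  assumes "A \<subseteq> E"
  shows "F\<^sub>0 \<subseteq> outside (curve A)"
proof
  fix x assume x: "x \<in> F\<^sub>0"
  have "F\<^sub>0 \<subseteq> - drawing V E pos \<gamma>" "connected F\<^sub>0"
    using F0(1) by (auto simp: faces_def dest: in_components_subset in_components_connected)
  then have disj: "F\<^sub>0 \<subseteq> - curve A"
    using curve_subset_drawing[OF assms] by blast
  then have "F\<^sub>0 \<subseteq> connected_component_set (- curve A) x"
    using x \<open>connected F\<^sub>0\<close> by (simp add: connected_component_maximal)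
  then have "\<not> bounded (connected_component_set (- curve A) x)"
    using F0(2) bounded_subset by blast
  then show "x \<in> outside (curve A)"
    using x disj by (auto simp: outside_def)
qed

text \<open>Vertices are limit points of the exterior face, and an open set containing one of them
  would meet that face.\<close>

lemma no_vertex_inside:
  assumes "A \<subseteq> E" "u \<in> V"
  shows "pos u \<notin> inside (curve A)"
proof
  assume *: "pos u \<in> inside (curve A)"
  have "open (inside (curve A))"
    using compact_curve[OF assms(1)] compact_imp_closed open_inside by blast
  moreover have "pos u \<in> closure F\<^sub>0"
    using F0(3) assms(2) by (auto simp: frontier_def)
  ultimately have "inside (curve A) \<inter> F\<^sub>0 \<noteq> {}"
    using * by (metis IntI empty_iff open_Int_closure_eq_empty)
  then show False
    using F0_subset_outside[OF assms(1)] inside_Int_outside[of "curve A"] by blast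
qed

text \<open>The outside of a bounded plane set is connected. Here it meets the exterior face but not
  the frontier of that face, so it cannot leave the face.\<close>

lemma outside_cycle: "outside (curve (cycle_edges c)) = F\<^sub>0"
proof
  let ?J = "curve (cycle_edges c)"
  have bounded: "bounded ?J"
    using compact_curve[OF c_cycle(4)] compact_imp_bounded by blast
  have "connected (outside ?J)"
    by (rule connected_outside[OF bounded]) simp
  moreover have "F\<^sub>0 \<noteq> {}"
    using F0(2) by auto
  moreover have "F\<^sub>0 \<subseteq> outside ?J"
    by (rule F0_subset_outside[OF c_cycle(4)])
  moreover have "outside ?J \<inter> frontier F\<^sub>0 = {}"
    unfolding frontier_F0 using outside_no_overlap by blast
  ultimately show "outside ?J \<subseteq> F\<^sub>0"
    using connected_Int_frontier[of "outside ?J" F\<^sub>0] by blast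
  show "F\<^sub>0 \<subseteq> outside ?J"
    by (rule F0_subset_outside[OF c_cycle(4)])
qed

text \<open>The open chord avoids both the outer cycle and the exterior face, and the latter is the
  whole outside of the cycle.\<close>

lemma chord_inside:
  assumes "e \<in> E" "e \<notin> cycle_edges c"
  shows "path_image (\<gamma> e) - pos ` e \<subseteq> inside (curve (cycle_edges c))"
proof
  fix x assume x: "x \<in> path_image (\<gamma> e) - pos ` e"
  have "curve {e} \<inter> curve (cycle_edges c) = pos ` (e \<inter> \<Union> (cycle_edges c))"
    using curve_Int_curve[of "{e}" "cycle_edges c"] assms c_cycle(4) by simp
  then have "x \<notin> curve (cycle_edges c)"
    using x by (auto simp: curve_def)
  moreover have "x \<in> drawing V E pos \<gamma>"
    using x assms(1) by (auto simp: drawing_def)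
  then have "x \<notin> F\<^sub>0"
    using F0(1) by (auto simp: faces_def dest: in_components_subset)
  ultimately show "x \<in> inside (curve (cycle_edges c))"
    using inside_Un_outside[of "curve (cycle_edges c)"] outside_cycle by blast
qed

lemma open_edge:
  assumes "e \<in> E"
  shows "path_image (\<gamma> e) - pos ` e \<noteq> {}" "connected (path_image (\<gamma> e) - pos ` e)"
    "path_image (\<gamma> e) \<subseteq> closure (path_image (\<gamma> e) - pos ` e)"
proof -
  have sp: "simple_path (\<gamma> e)"
    using arc_edge[OF assms] arc_imp_simple_path by blast
  show "path_image (\<gamma> e) - pos ` e \<noteq> {}"
    using simple_path_endless[OF sp] ends_edge[OF assms] by auto
  show "connected (path_image (\<gamma> e) - pos ` e)"
    using connected_simple_path_endless[OF sp] ends_edge[OF assms] by simp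
  show "path_image (\<gamma> e) \<subseteq> closure (path_image (\<gamma> e) - pos ` e)"
    using path_image_subset_closure_endless[OF sp] ends_edge[OF assms] by simp
qed

lemma vertex_off_curve:
  assumes "A \<subseteq> E" "u \<in> V" "u \<notin> \<Union>A"
  shows "pos u \<notin> closure (inside (curve A))"
  using closure_inside_subset[OF compact_imp_closed[OF compact_curve[OF assms(1)]]]
    no_vertex_inside[OF assms(1,2)] pos_in_curve_iff[OF assms(1,2)] assms(3) by blast

section \<open>Chords do not cross\<close>

text \<open>The chord \<open>?e\<close> cuts the inside of the outer cycle into two open regions.
  The open edge \<open>?f\<close> is connected and lies in one of them, but neither region has both
  \<open>v x\<close> and \<open>v y\<close> in its closure.\<close>

lemma chords_noncrossing:
  assumes less: "a < x" "x < b" "b < y" "y < n"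
    and e: "{v a, v b} \<in> E" and f: "{v x, v y} \<in> E"
  shows False
proof -
  let ?e = "{v a, v b}" and ?f = "{v x, v y}"
  let ?P = "walk_edges v a b" and ?Q = "walk_edges v b (a + n)"
  let ?J = "curve (cycle_edges c)"
  have inj: "inj_on v {a..<a + n}" "inj_on v {a..b}" "inj_on v {b..a + n}"
    using less by (auto intro: inj_v[of _ a] inj_v[of _ b])
  have va: "v (a + n) = v a"
    by (rule v_plus_n)
  have cyc: "cycle_edges c = ?P \<union> ?Q"
  proof -
    have "{a..<a + n} = {a..<b} \<union> {b..<a + n}"
      using less by auto
    then show ?thesis
      unfolding cycle_edges_eq_walk[of a] walk_edges_def by (simp add: image_Un)
  qed
  then have PQ: "?P \<subseteq> E" "?Q \<subseteq> E"
    using c_cycle(4) by auto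
  have UP: "\<Union> ?P = v ` {a..b}" and UQ: "\<Union> ?Q = v ` {b..a + n}"
    using less by (intro Union_walk_edges; simp)+
  have UPQ: "v ` {a..b} \<inter> v ` {b..a + n} = ?e"
  proof
    show "v ` {a..b} \<inter> v ` {b..a + n} \<subseteq> ?e"
    proof
      fix w assume "w \<in> v ` {a..b} \<inter> v ` {b..a + n}"
      then obtain k m where km: "w = v k" "w = v m" "k \<in> {a..b}" "m \<in> {b..a + n}"
        by blast
      show "w \<in> ?e"
      \<comment> \<open>Index \<open>a + n\<close> repeats the vertex of index \<open>a\<close> and
        is outside the range on which \<open>v\<close> is injective.\<close>
      proof (cases "m = a + n")
        case True
        then show ?thesis
          using km va by simp
      next
        case False
        then have "k = m"
          using km less by (intro inj_onD[OF inj(1)]) auto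
        then show ?thesis
          using km by auto
      qed
    qed
    show "?e \<subseteq> v ` {a..b} \<inter> v ` {b..a + n}"
      using less va by (auto intro: image_eqI[of _ _ "a + n"])
  qed
  have eP: "?e \<notin> ?P"
    using chord_notin_walk_edges[OF inj(2)] less by simp
  have eQ: "?e \<notin> ?Q"
    using chord_notin_walk_edges[OF inj(3)] less va by (simp add: insert_commute)
  have PQ_disjoint: "?P \<inter> ?Q = {}"
  proof (rule ccontr)
    assume "?P \<inter> ?Q \<noteq> {}"
    then obtain g where g: "g \<in> ?P" "g \<in> ?Q"
      by blast
    then have "g \<subseteq> ?e"
      using UP UQ UPQ by blast
    moreover have "card g = 2" "card ?e = 2"
      using g PQ card_edge e by auto
    ultimately have "g = ?e"
      by (intro card_subset_eq) auto
    then show False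
      using g eP by simp
  qed
  have vx: "v x \<notin> v ` {b..a + n}"
  proof
    assume "v x \<in> v ` {b..a + n}"
    then obtain m where m: "m \<in> {b..a + n}" "v x = v m"
      by auto
    show False
    proof (cases "m = a + n")
      case True
      then have "x = a"
        using m va less by (intro inj_onD[OF inj(1)]) auto
      then show False
        using less by simp
    next
      case False
      then have "x = m"
        using m less by (intro inj_onD[OF inj(1)]) auto
      then show False
        using less m by simp
    qed
  qed
  have vy: "v y \<notin> v ` {a..b}"
  proof
    assume "v y \<in> v ` {a..b}"
    then obtain m where m: "m \<in> {a..b}" "v y = v m"
      by auto
    then have "y = m"
      using less by (intro inj_onD[OF inj(1)]) auto
    then show False
      using less m by simp
  qed
  have fcyc: "?f \<notin> cycle_edges c"
    using vx vy UP UQ cyc by blast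
  have ef: "?e \<noteq> ?f"
  proof
    assume "?e = ?f"
    then have "v y \<in> ?e"
      by simp
    then show False
      using vy less by auto
  qed
  obtain c1 where c1: "arc c1" "pathstart c1 = pos (v a)" "pathfinish c1 = pos (v b)"
    "path_image c1 = curve ?P"
    using walk_arc[OF _ inj(2) PQ(1)] less by auto
  obtain c2 where c2: "arc c2" "pathstart c2 = pos (v b)" "pathfinish c2 = pos (v a)"
    "path_image c2 = curve ?Q"
    using walk_arc[OF _ inj(3) PQ(2)] less va by auto
  obtain g where g: "arc g" "pathstart g = pos (v a)" "pathfinish g = pos (v b)"
    "path_image g = path_image (\<gamma> ?e)"
    using oriented_edge_arc[OF e] by blast
  have Pe: "curve ?P \<inter> path_image (\<gamma> ?e) = pos ` ?e"
  proof -
    have "curve ?P \<inter> curve {?e} = pos ` (v ` {a..b} \<inter> ?e)"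
      using curve_Int_curve[of ?P "{?e}"] PQ e eP UP by simp
    also have "v ` {a..b} \<inter> ?e = ?e"
      using UPQ by blast
    finally show ?thesis
      by (simp add: curve_def)
  qed
  have Qe: "curve ?Q \<inter> path_image (\<gamma> ?e) = pos ` ?e"
  proof -
    have "curve ?Q \<inter> curve {?e} = pos ` (v ` {b..a + n} \<inter> ?e)"
      using curve_Int_curve[of ?Q "{?e}"] PQ e eQ UQ by simp
    also have "v ` {b..a + n} \<inter> ?e = ?e"
      using UPQ by blast
    finally show ?thesis
      by (simp add: curve_def)
  qed
  have J: "?J = curve ?P \<union> curve ?Q"
    by (simp add: cyc curve_Un)
  have e_in: "path_image (\<gamma> ?e) - pos ` ?e \<subseteq> inside ?J"
    using chord_inside[OF e] eP eQ cyc by simp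
  let ?I1 = "inside (curve (insert ?e ?P))" and ?I2 = "inside (curve (insert ?e ?Q))"
  \<comment> \<open>Theta-curve theorem for the two boundary paths and the chord. The path
    \<open>c2\<close> is reversed so that all three arcs run from \<open>v a\<close> to
    \<open>v b\<close>.\<close>
  have split: "?I1 \<inter> ?I2 = {}" "?I1 \<union> ?I2 \<union> (path_image (\<gamma> ?e) - pos ` ?e) = inside ?J"
  proof -
    have *: "simple_path c1" "simple_path (reversepath c2)" "simple_path g" "pos (v a) \<noteq> pos (v b)"
      using arc_imp_simple_path[OF c1(1)] arc_imp_simple_path[OF arc_reversepath[OF c2(1)]]
        arc_imp_simple_path[OF g(1)] arc_distinct_ends[OF g(1)] g(2,3) by simp_all
    have ints: "path_image c1 \<inter> path_image (reversepath c2) = {pos (v a), pos (v b)}"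
      "path_image c1 \<inter> path_image g = {pos (v a), pos (v b)}"
      "path_image (reversepath c2) \<inter> path_image g = {pos (v a), pos (v b)}"
      using c1 c2 g Pe Qe curve_Int_curve[OF PQ PQ_disjoint] UP UQ UPQ by simp_all
    have ne: "path_image g \<inter> inside (path_image c1 \<union> path_image (reversepath c2)) \<noteq> {}"
      using e_in open_edge(1)[OF e] g c1 c2 J by auto
    show "?I1 \<inter> ?I2 = {}" "?I1 \<union> ?I2 \<union> (path_image (\<gamma> ?e) - pos ` ?e) = inside ?J"
      by (rule split_inside_simple_closed_curve[OF *(1) c1(2,3) *(2) _ _ *(3) g(2,3) *(4) ints ne];
          use c1 c2 g J in \<open>simp add: curve_insert Un_commute\<close>)+
  qed
  let ?int_f = "path_image (\<gamma> ?f) - pos ` ?f"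
  have "?int_f \<inter> path_image (\<gamma> ?e) = {}"
    using edge_Int_edge[OF e f ef] by blast
  then have f0: "?int_f \<subseteq> ?I1 \<union> ?I2"
    using chord_inside[OF f fcyc] split(2) by blast
  have ePE: "insert ?e ?P \<subseteq> E" "insert ?e ?Q \<subseteq> E"
    using PQ e by auto
  have "open ?I1" "open ?I2"
    by (intro open_inside compact_imp_closed compact_curve ePE)+
  then have "?I1 \<inter> ?int_f = {} \<or> ?I2 \<inter> ?int_f = {}"
    using split(1) f0 by (intro connectedD[OF open_edge(2)[OF f]]) auto
  then have "?int_f \<subseteq> ?I1 \<or> ?int_f \<subseteq> ?I2"
    using f0 by blast
  then have cl: "path_image (\<gamma> ?f) \<subseteq> closure ?I1 \<or> path_image (\<gamma> ?f) \<subseteq> closure ?I2"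
    using open_edge(3)[OF f] closure_mono by blast
  have "pos (v x) \<in> path_image (\<gamma> ?f)" "pos (v y) \<in> path_image (\<gamma> ?f)"
    using edge_Int_vertices[OF f] by auto
  moreover have "pos (v y) \<notin> closure ?I1"
    using UP UPQ vy by (intro vertex_off_curve[OF ePE(1) v_in_V]) auto
  moreover have "pos (v x) \<notin> closure ?I2"
    using UQ UPQ vx by (intro vertex_off_curve[OF ePE(2) v_in_V]) auto
  ultimately show False
    using cl by blast
qed

section \<open>The triangular face at an edge\<close>

text \<open>The third vertex of the face touching the edge from within \<open>?C\<close> is in the
  closure of the inside, hence on \<open>?C\<close> itself. The edge may also be the boundary edge
  between indices 0 and \<open>n - 1\<close>.\<close>

lemma edge_apex:
  assumes less: "i + 2 \<le> j" "j < n" and e: "{v i, v j} \<in> E"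
  shows "\<exists>k. i < k \<and> k < j \<and> {v i, v k} \<in> E \<and> {v k, v j} \<in> E"
proof -
  let ?e = "{v i, v j}" and ?P = "walk_edges v i j"
  let ?C = "curve (insert ?e ?P)"
  have inj: "inj_on v {i..j}"
    using less by (intro inj_v[of _ i]) auto
  have P: "?P \<subseteq> E"
    using walk_edges_subset[of j i] c_cycle(4) less by auto
  then have eP: "insert ?e ?P \<subseteq> E"
    using e by simp
  have UP: "\<Union> ?P = v ` {i..j}"
    using less by (intro Union_walk_edges) simp
  have notin: "?e \<notin> ?P"
    using chord_notin_walk_edges[OF inj less(1)] .
  obtain c1 where c1: "arc c1" "pathstart c1 = pos (v i)" "pathfinish c1 = pos (v j)"
    "path_image c1 = curve ?P"
    using walk_arc[OF _ inj P] less by auto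
  obtain g where g: "arc g" "pathstart g = pos (v j)" "pathfinish g = pos (v i)"
    "path_image g = path_image (\<gamma> ?e)"
    using oriented_edge_arc[of "v j" "v i"] e by (auto simp: insert_commute)
  have "curve ?P \<inter> curve {?e} = pos ` (v ` {i..j} \<inter> ?e)"
    using curve_Int_curve[of ?P "{?e}"] P e notin UP by simp
  then have "simple_path (c1 +++ g)"
    using c1 g by (intro simple_path_join_loop) (auto simp: curve_def)
  moreover have C: "path_image (c1 +++ g) = ?C"
    using c1 g by (simp add: path_image_join curve_insert Un_commute)
  ultimately have frontier_C: "frontier (inside ?C) = ?C"
    using Jordan_inside_outside[of "c1 +++ g"] c1 g by simp
  \<comment> \<open>Around an inner point \<open>p\<close> of the edge, a small ball meets no other
    edge and no vertex. A point \<open>q\<close> of this ball inside \<open>?C\<close> then selects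
    the face.\<close>
  obtain p where p: "p \<in> path_image (\<gamma> ?e)" "p \<notin> pos ` ?e"
    using open_edge(1)[OF e] by blast
  let ?K = "curve (E - {?e}) \<union> pos ` V"
  have "closed ?K"
    using compact_curve[of "E - {?e}"] finite_V
    by (intro closed_Un compact_imp_closed finite_imp_closed) auto
  moreover have "p \<notin> ?K"
    using p edge_Int_vertices[OF e] edge_Int_edge[OF e] by (fastforce simp: curve_def)
  ultimately obtain r where r: "r > 0" "ball p r \<subseteq> - ?K"
    by (metis ComplI open_Compl open_contains_ball)
  have "p \<in> closure (inside ?C)"
    using p frontier_C by (auto simp: frontier_def curve_insert)
  then obtain q where q: "q \<in> inside ?C" "q \<in> ball p r"
    using r(1) by (metis closure_approachable dist_commute mem_ball)
  have "q \<notin> ?C"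
    using q(1) inside_no_overlap by blast
  then have q_off: "q \<in> - drawing V E pos \<gamma>"
    using q(2) r(2) by (auto simp: drawing_eq curve_def)
  define F where "F = connected_component_set (- drawing V E pos \<gamma>) q"
  have F: "F \<in> faces V E pos \<gamma>"
    using q_off by (auto simp: faces_def F_def components_def)
  have qF: "q \<in> F"
    using q_off by (simp add: F_def)
  have F_off: "F \<subseteq> - drawing V E pos \<gamma>"
    by (simp add: F_def connected_component_subset)
  have F_in: "F \<subseteq> inside ?C"
  proof -
    have "F \<inter> frontier (inside ?C) = {}"
      using F_off curve_subset_drawing[OF eP] frontier_C by blast
    then show ?thesis
      using connected_Int_frontier[of F "inside ?C"] qF q(1) connected_connected_component F_def
      by blast
  qed
  have "bounded F"
    using F_in compact_curve[OF eP] by (meson bounded_inside bounded_subset compact_imp_bounded)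
  then obtain t where t: "length t = 3" "is_cycle V E t" "frontier F = curve (cycle_edges t)"
    using inner[OF F] by (auto simp: bounded_by_cycle_def curve_def)
  \<comment> \<open>The ball contains \<open>q\<close> in \<open>F\<close> and \<open>p\<close>
    outside \<open>F\<close>. A frontier point in the ball can only lie on \<open>?e\<close>, which
    makes \<open>?e\<close> a side of the triangle.\<close>
  have "ball p r \<inter> frontier F \<noteq> {}"
  proof (rule connected_Int_frontier)
    show "ball p r \<inter> F \<noteq> {}"
      using q(2) qF by blast
    show "ball p r - F \<noteq> {}"
    proof -
      have "p \<in> drawing V E pos \<gamma>"
        using p(1) e by (auto simp: drawing_def)
      then show ?thesis
        using r(1) F_off centre_in_ball by blast
    qed
  qed simp
  then obtain z f where z: "z \<in> ball p r" "f \<in> cycle_edges t" "z \<in> path_image (\<gamma> f)"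
    using t(3) by (auto simp: curve_def)
  have tE: "cycle_edges t \<subseteq> E"
    using t(2) by (simp add: is_cycle_def)
  have "z \<notin> curve (E - {?e})"
    using z(1) r(2) by blast
  then have "f = ?e"
    using z(2,3) tE unfolding curve_def by blast
  then have et: "?e \<in> cycle_edges t"
    using z(2) by simp
  obtain t0 t1 t2 where t_eq: "t = [t0, t1, t2]"
    using t(1) by (metis (no_types) length_0_conv length_Suc_conv numeral_3_eq_3)
  have dist: "t0 \<noteq> t1" "t1 \<noteq> t2" "t0 \<noteq> t2" and tV: "t0 \<in> V" "t1 \<in> V" "t2 \<in> V"
    using t(2) t_eq by (auto simp: is_cycle_def)
  have edges: "cycle_edges t = {{t0, t1}, {t1, t2}, {t2, t0}}"
    unfolding t_eq by (rule cycle_edges_triangle)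
  have "\<exists>w\<in>V. w \<noteq> v i \<and> w \<noteq> v j \<and> {v i, w} \<in> cycle_edges t \<and> {w, v j} \<in> cycle_edges t"
  proof -
    consider "?e = {t0, t1}" | "?e = {t1, t2}" | "?e = {t2, t0}"
      using et unfolding edges by blast
    then show ?thesis
    proof cases
      case 1
      then show ?thesis
        using dist tV unfolding edges by (intro bexI[of _ t2]) (auto simp: doubleton_eq_iff)
    next
      case 2
      then show ?thesis
        using dist tV unfolding edges by (intro bexI[of _ t0]) (auto simp: doubleton_eq_iff)
    next
      case 3
      then show ?thesis
        using dist tV unfolding edges by (intro bexI[of _ t1]) (auto simp: doubleton_eq_iff)
    qed
  qed
  then obtain w where w: "w \<in> V" "w \<noteq> v i" "w \<noteq> v j" "{v i, w} \<in> cycle_edges t"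
    "{w, v j} \<in> cycle_edges t"
    by blast
  have "pos w \<in> frontier F"
    unfolding t(3) using pos_in_curve_iff[OF tE w(1)] w(4) by blast
  then have "pos w \<in> closure (inside ?C)"
    using closure_mono[OF F_in] by (auto simp: frontier_def)
  then have "w \<in> \<Union> (insert ?e ?P)"
    using vertex_off_curve[OF eP w(1)] by blast
  then obtain k where "k \<in> {i..j}" "w = v k"
    using UP w(2,3) by auto
  then show ?thesis
    using w tE by (intro exI[of _ k]) (auto simp: less_le)
qed

section \<open>Transfer between the drawing and the triangulated polygon\<close>

lemma polygon_triangulation_cycle:
  "polygon_triangulation n (\<lambda>i j. i < n \<and> j < n \<and> {v i, v j} \<in> E)"
proof
  show "\<not> (x < n \<and> x < n \<and> {v x, v x} \<in> E)" for x
    using card_edge[of "{v x, v x}"] by auto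
  show "x < n \<and> Suc x < n \<and> {v x, v (Suc x)} \<in> E" if "Suc x < n" for x
    using that c_cycle(4) unfolding cycle_edges_eq_walk[of 0] walk_edges_def by auto
  \<comment> \<open>The closing edge of the cycle ends at index \<open>n\<close>, which is the
    vertex of index 0; this provides the root edge.\<close>
  have "{v (n - 1), v (Suc (n - 1))} \<in> cycle_edges c"
    using c_cycle(1) unfolding cycle_edges_eq_walk[of 0] walk_edges_def by (intro imageI) auto
  moreover have "v (Suc (n - 1)) = v 0"
  proof -
    have "Suc (n - 1) = 0 + n"
      using c_cycle(1) by simp
    then show ?thesis
      using v_plus_n[of 0] by metis
  qed
  ultimately have "{v 0, v (n - 1)} \<in> E"
    using c_cycle(4) by (auto simp: insert_commute)
  then show "0 < n \<and> n - 1 < n \<and> {v 0, v (n - 1)} \<in> E"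
    using c_cycle(1) by auto
  show False if "a < n \<and> b < n \<and> {v a, v b} \<in> E" "x < n \<and> y < n \<and> {v x, v y} \<in> E"
    "a < x" "x < b" "b < y" for a b x y
    using chords_noncrossing that by blast
  show "\<exists>m. x < m \<and> m < y \<and> (x < n \<and> m < n \<and> {v x, v m} \<in> E) \<and> (m < n \<and> y < n \<and> {v m, v y} \<in> E)"
    if "x < n \<and> y < n \<and> {v x, v y} \<in> E" "Suc x < y" for x y
    using edge_apex[of x y] that by fastforce
qed (auto simp: insert_commute)

text \<open>A vertex outside the closed neighbourhood has an undominated index, so a surviving path
  on three vertices would give a forbidden path of indices.\<close>

lemma isolating_set:
  assumes "5 \<le> card V"
  shows "\<exists>S. K12_isolating V E S \<and> 5 * card S \<le> card V"
proof -
  let ?adj = "\<lambda>i j. i < n \<and> j < n \<and> {v i, v j} \<in> E"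
  have card_V: "card V = n"
    using cycle_vertices c_cycle(2) distinct_card by metis
  obtain S where S: "S \<subseteq> {..<n}" "isolates ?adj UNIV S" "5 * card S \<le> n"
    using polygon_triangulation_isolating_set[OF polygon_triangulation_cycle] assms card_V by auto
  have index: "\<exists>i<n. u = v i" if "u \<in> V" for u
    using that cycle_vertices v_eq_nth by (metis in_set_conv_nth)
  have und: "undominated ?adj S i" if "v i \<notin> closed_nbhd V E (v ` S)" for i
    using that v_in_V by (auto simp: closed_nbhd_def undominated_def)
  have "K12_isolating V E (v ` S)"
    unfolding K12_isolating_def contains_K12_def
  proof (intro conjI notI)
    show "v ` S \<subseteq> V"
      using v_in_V by auto
    assume "\<exists>a b d. distinct [a, b, d] \<and> {a, b, d} \<subseteq> V - closed_nbhd V E (v ` S) \<and>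
      {a, b} \<in> delete_edges E (closed_nbhd V E (v ` S)) \<and>
      {b, d} \<in> delete_edges E (closed_nbhd V E (v ` S))"
    then obtain a b d where abd: "a \<noteq> d" "{a, b, d} \<subseteq> V - closed_nbhd V E (v ` S)"
      "{a, b} \<in> E" "{b, d} \<in> E"
      by (auto simp: delete_edges_def)
    obtain i j k where ijk: "i < n" "j < n" "k < n" "a = v i" "b = v j" "d = v k"
      using index abd(2) by (metis DiffD1 insert_subset)
    have "undominated ?adj S i" "undominated ?adj S j" "undominated ?adj S k"
      using und abd(2) ijk by auto
    then show False
      using S(2) abd ijk unfolding isolates_def by blast
  qed
  moreover have "card (v ` S) \<le> card S"
    using S(1) finite_subset by (intro card_image_le) blast
  ultimately show ?thesis
    using S(3) card_V by (intro exI[of _ "v ` S"]) auto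
qed

end

theorem theorem1p2:
  fixes V :: "'a set" and E :: "'a set set" and n :: nat
  assumes "maximal_outerplanar V E"
    and "card V = n"
    and "n \<ge> 5"
  shows "real (iota1 V E) \<le> real n / 5"
proof -
  obtain pos \<gamma> where graph: "simple_graph V E" and embedding: "plane_embedding V E pos \<gamma>"
    and outer: "\<forall>F\<in>faces V E pos \<gamma>. \<not> bounded F \<longrightarrow>
      pos ` V \<subseteq> frontier F \<and> (\<exists>c. bounded_by_cycle V E \<gamma> F c)"
    and inner: "\<forall>F\<in>faces V E pos \<gamma>. bounded F \<longrightarrow>
      (\<exists>c. length c = 3 \<and> bounded_by_cycle V E \<gamma> F c)"
    using assms(1) unfolding maximal_outerplanar_def by blast
  interpret plane_graph V E pos \<gamma>
    by unfold_locales (rule graph embedding)+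
  \<comment> \<open>An exterior face exists because the drawing is compact, so its complement has an
    unbounded component.\<close>
  have "bounded (- (- drawing V E pos \<gamma>))"
    using compact_drawing compact_imp_bounded by simp
  then obtain F where F: "F \<in> faces V E pos \<gamma>" "\<not> bounded F"
    using cobounded_unbounded_components unfolding faces_def by blast
  then obtain c where c: "pos ` V \<subseteq> frontier F" "bounded_by_cycle V E \<gamma> F c"
    using outer by blast
  interpret mop_drawing V E pos \<gamma> F c
    by unfold_locales (use F c inner in auto)
  obtain S where S: "K12_isolating V E S" "5 * card S \<le> n"
    using isolating_set assms(2,3) by auto
  have "iota1 V E \<le> card S"
    unfolding iota1_def using S(1) by (intro Least_le) blast
  then show ?thesis
    using S(2) by simp
qed

end
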